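(* Let $R\ge 1$, let $F\subset\mathbb{C}$ be a field and let $K=F(t)\subset\mathbb{C}$ be a cyclic Galois extension of $F$ of degree $R$ with Galois group generated by $\sigma$, let $\delta\in F^{*}$ be such that the cyclic algebra $(K/F,\sigma,\delta)$ is a division algebra, and let $\theta>0$ be a normalization constant. Consider the $R\times R$ design $M_{CDA}$ in the $R^2$ complex variables $f_{k,i}$, $0\le k,i\le R-1$, whose entry in row $a$ and column $b$ ($0\le a,b\le R-1$) is $$(M_{CDA})_{a,b}=\frac{1}{\sqrt{\theta}}\,\epsilon_{a,b}\sum_{i=0}^{R-1} f_{(a-b)\bmod R,\;i}\;\sigma^{b}(t^{i}),\qquad \epsilon_{a,b}=\begin{cases}1,& a\ge b,\\ \delta,& a<b.\end{cases}$$ Then $M_{CDA}$ is a conjugate linear row-orthogonal distributed space-time code (CLRO-DSTC).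
   Context: Let $s$ be the column vector of the complex variables of a design with $T_2$ rows and $R$ columns ($T_1$ variables). The design is called a conjugate linear row-orthogonal distributed space-time code (CLRO-DSTC) if: (Condition 1) every column contains only the variables or only the conjugates of the variables, i.e. the $j$-th column is equal to either $A_js$ or $A_js^*$ for a single matrix $A_j\in\mathbb{C}^{T_2\times T_1}$, called the relay matrix of the $j$-th relay; and (Condition 2) for every $j$, the rows of the relay matrix $A_j$ are pairwise orthogonal (with respect to the standard Hermitian inner product), i.e. $A_jA_j^H$ is diagonal. Here $s^*$ is the entrywise conjugate of $s$ and $(\cdot)^H$ the conjugate transpose. The cyclic algebra $(K/F,\sigma,\delta)$ is $\bigoplus_{k=0}^{R-1}z^kK$ with $z^R=\delta$ and $xz=z\sigma(x)$ for $x\in K$. *)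

theory Defs
  imports
    "HOL-Algebra.Generated_Fields"
    "HOL-Algebra.Embedded_Algebras"
    "HOL-Algebra.Bij"
    "HOL-Algebra.Algebraic_Closure_Type"
    "Jordan_Normal_Form.Schur_Decomposition"
begin

section \<open>Cyclic Galois extensions inside the complex numbers\<close>

abbreviation complex_ring :: "complex ring" where
  "complex_ring \<equiv> ring_of_type_algebra"

abbreviation subfield_ring :: "complex set \<Rightarrow> complex ring" where
  "subfield_ring K \<equiv> complex_ring\<lparr>carrier := K\<rparr>"

text \<open>As in \<^const>\<open>BijGroup\<close>, automorphisms of \<open>K\<close> are extensional functions, i.e. they are
  \<^const>\<open>undefined\<close> outside \<open>K\<close>; the multiplication is composition.\<close>

definition galois_group :: "complex set \<Rightarrow> complex set \<Rightarrow> (complex \<Rightarrow> complex) monoid" where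
  "galois_group F K = (BijGroup K)
     \<lparr>carrier := {\<tau> \<in> Bij K. \<tau> \<in> Ring.ring_hom (subfield_ring K) (subfield_ring K)
                            \<and> (\<forall>x\<in>F. \<tau> x = x)}\<rparr>"

definition finite_galois_extension :: "complex set \<Rightarrow> complex set \<Rightarrow> bool" where
  "finite_galois_extension F K \<longleftrightarrow>
     subfield F complex_ring \<and> subfield K complex_ring \<and> F \<subseteq> K
     \<and> ring.finite_dimension complex_ring F K
     \<and> {x \<in> K. \<forall>\<tau> \<in> carrier (galois_group F K). \<tau> x = x} = F"

definition cyclic_galois_extension ::
  "nat \<Rightarrow> complex set \<Rightarrow> complex set \<Rightarrow> (complex \<Rightarrow> complex) \<Rightarrow> bool" where
  "cyclic_galois_extension R F K \<sigma> \<longleftrightarrow>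
     finite_galois_extension F K
     \<and> ring.dimension complex_ring R F K
     \<and> \<sigma> \<in> carrier (galois_group F K)
     \<and> carrier (galois_group F K) = generate (galois_group F K) {\<sigma>}"

section \<open>Cyclic algebras\<close>

text \<open>The element \<open>\<Sum>k<R. z\<^sup>k u\<^sub>k\<close> of \<open>\<Oplus>k<R. z\<^sup>k K\<close> is represented by its coefficient
  function \<open>u\<close>, extensional on \<open>{..<R}\<close>. The relations \<open>x z = z \<sigma>(x)\<close> and \<open>z\<^sup>R = \<delta>\<close> give
  \<open>(z\<^sup>k x) (z\<^sup>l y) = z\<^sup>k\<^sup>+\<^sup>l \<sigma>\<^sup>l(x) y\<close>, where for \<open>k + l \<ge> R\<close> the power \<open>z\<^sup>k\<^sup>+\<^sup>l\<close> reduces to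
  \<open>\<delta> z\<^sup>k\<^sup>+\<^sup>l\<^sup>-\<^sup>R\<close>.\<close>

definition cyclic_algebra ::
  "nat \<Rightarrow> complex set \<Rightarrow> (complex \<Rightarrow> complex) \<Rightarrow> complex \<Rightarrow> (nat \<Rightarrow> complex) ring" where
  "cyclic_algebra R K \<sigma> \<delta> =
     \<lparr>carrier = {..<R} \<rightarrow>\<^sub>E K,
      monoid.mult = (\<lambda>u v. \<lambda>m\<in>{..<R}. \<Sum>k<R. \<Sum>l<R.
                if (k + l) mod R = m
                then (if k + l < R then 1 else \<delta>) * (\<sigma> ^^ l) (u k) * v l
                else 0),
      monoid.one = (\<lambda>m\<in>{..<R}. if m = 0 then 1 else 0),
      ring.zero = (\<lambda>m\<in>{..<R}. 0),
      ring.add = (\<lambda>u v. \<lambda>m\<in>{..<R}. u m + v m)\<rparr>"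

definition division_algebra :: "('a, 'm) ring_scheme \<Rightarrow> bool" where
  "division_algebra A \<longleftrightarrow> ring A \<and> Units A = carrier A - {\<zero>\<^bsub>A\<^esub>}"

section \<open>Designs and CLRO-DSTCs\<close>

text \<open>A design with \<open>T1\<close> complex variables, \<open>T2\<close> rows and \<open>R\<close> columns is the matrix-valued function
  of the column vector \<open>s\<close> of its variables.\<close>

type_synonym design = "complex vec \<Rightarrow> complex mat"

definition is_relay_matrix :: "nat \<Rightarrow> nat \<Rightarrow> design \<Rightarrow> nat \<Rightarrow> complex mat \<Rightarrow> bool" where
  "is_relay_matrix T1 T2 M j A \<longleftrightarrow>
     A \<in> carrier_mat T2 T1
     \<and> ((\<forall>s \<in> carrier_vec T1. col (M s) j = A *\<^sub>v s)
        \<or> (\<forall>s \<in> carrier_vec T1. col (M s) j = A *\<^sub>v conjugate s))"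

definition CLRO_DSTC :: "nat \<Rightarrow> nat \<Rightarrow> nat \<Rightarrow> design \<Rightarrow> bool" where
  "CLRO_DSTC T1 T2 R M \<longleftrightarrow>
     (\<forall>s \<in> carrier_vec T1. M s \<in> carrier_mat T2 R)
     \<and> (\<exists>A. \<forall>j<R. is_relay_matrix T1 T2 M j (A j) \<and> diagonal_mat (A j * mat_adjoint (A j)))"

text \<open>The variable \<open>f\<^sub>k\<^sub>,\<^sub>i\<close> is the entry \<open>k * R + i\<close> of the vector \<open>s\<close> of length \<open>R * R\<close>. Since
  \<open>b < R\<close>, the index \<open>(a - b) mod R\<close> is \<open>(a + R - b) mod R\<close>, which avoids truncated subtraction.\<close>

definition M_CDA ::
  "nat \<Rightarrow> real \<Rightarrow> complex \<Rightarrow> (complex \<Rightarrow> complex) \<Rightarrow> complex \<Rightarrow> design" where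
  "M_CDA R \<theta> \<delta> \<sigma> t s = mat R R (\<lambda>(a, b).
     complex_of_real (1 / sqrt \<theta>) * (if a \<ge> b then 1 else \<delta>)
       * (\<Sum>i<R. s $ (((a + R - b) mod R) * R + i) * (\<sigma> ^^ b) (t ^ i)))"

end

(* Row a of the b-th relay matrix is supported on the block of variables f_{k,i} with
   k = (a - b) mod R. For fixed b these blocks are disjoint for distinct a, so distinct rows are
   orthogonal whatever the entries are. *)

theory Submission
  imports Defs
begin

text \<open>Position \<open>m\<close> of the variable vector holds f_{k,i} with k =
  \<open>m div R\<close> and i = \<open>m mod R\<close>. The test on \<open>m div R\<close> thus
  selects the variables occurring in row \<open>a\<close> of column \<open>b\<close>, and
  \<open>m mod R\<close> gives the exponent of \<open>t\<close>.\<close>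

definition CDA_relay ::
  "nat \<Rightarrow> real \<Rightarrow> complex \<Rightarrow> (complex \<Rightarrow> complex) \<Rightarrow> complex \<Rightarrow> nat \<Rightarrow> complex mat" where
  "CDA_relay R \<theta> \<delta> \<sigma> t b = mat R (R * R) (\<lambda>(a, m).
     if m div R = (a + R - b) mod R
     then complex_of_real (1 / sqrt \<theta>) * (if a \<ge> b then 1 else \<delta>) * (\<sigma> ^^ b) (t ^ (m mod R))
     else 0)"

text \<open>Collapses a matrix-vector product over all \<open>R * R\<close> variables to the sum
  over one block that defines an entry of \<open>M_CDA\<close>. The map i \<mapsto>
  \<open>k * R + i\<close> enumerates the block, and \<open>k < R\<close> keeps it inside the range
  of summation.\<close>

lemma sum_block:
  fixes g :: "nat \<Rightarrow> 'a::comm_monoid_add"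
  assumes "k < R"
  shows "(\<Sum>m<R * R. if m div R = k then g m else 0) = (\<Sum>i<R. g (k * R + i))"
proof -
  have bound: "k * R + i < R * R" if "i < R" for i
  proof -
    have "k * R + i < Suc k * R" using that by simp
    also have "\<dots> \<le> R * R" using assms by (intro mult_le_mono1) simp
    finally show ?thesis .
  qed
  have "(\<Sum>m<R * R. if m div R = k then g m else 0) = (\<Sum>m\<in>{m. m < R * R \<and> m div R = k}. g m)"
    by (intro sum.mono_neutral_cong_right) auto
  also have "\<dots> = (\<Sum>i<R. g (k * R + i))"
    using assms bound
    by (intro sum.reindex_bij_witness[of _ "\<lambda>i. k * R + i" "\<lambda>m. m mod R"])
       (auto simp: div_mult_mod_eq)
  finally show ?thesis .
qed

text \<open>Both \<open>a + R - b\<close> and \<open>a' + R - b\<close> lie strictly between 0 and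
  \<open>2 * R\<close>, so reduction subtracts \<open>R\<close> at most once. If it does so for only
  one of them, \<open>a\<close> and \<open>a'\<close> would differ by \<open>R\<close>, which is
  impossible below \<open>R\<close>.\<close>

lemma cyclic_shift_inj:
  fixes a a' b R :: nat
  assumes "a < R" "a' < R" "b < R" "(a + R - b) mod R = (a' + R - b) mod R"
  shows "a = a'"
  using assms by (auto simp: mod_if split: if_splits)

lemma col_M_CDA:
  assumes "b < R" and s: "s \<in> carrier_vec (R * R)"
  shows "col (M_CDA R \<theta> \<delta> \<sigma> t s) b = CDA_relay R \<theta> \<delta> \<sigma> t b *\<^sub>v s"
proof (rule eq_vecI)
  show "dim_vec (col (M_CDA R \<theta> \<delta> \<sigma> t s) b) = dim_vec (CDA_relay R \<theta> \<delta> \<sigma> t b *\<^sub>v s)"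
    by (simp add: M_CDA_def CDA_relay_def)
next
  fix a assume "a < dim_vec (CDA_relay R \<theta> \<delta> \<sigma> t b *\<^sub>v s)"
  then have a: "a < R" by (simp add: CDA_relay_def)
  define k where "k = (a + R - b) mod R"
  define c where "c = complex_of_real (1 / sqrt \<theta>) * (if a \<ge> b then 1 else \<delta>)"
  have k: "k < R" using a by (simp add: k_def)
  have "(CDA_relay R \<theta> \<delta> \<sigma> t b *\<^sub>v s) $ a
      = (\<Sum>m<R * R. if m div R = k then c * (\<sigma> ^^ b) (t ^ (m mod R)) * s $ m else 0)"
  proof -
    have "CDA_relay R \<theta> \<delta> \<sigma> t b $$ (a, m)
        = (if m div R = k then c * (\<sigma> ^^ b) (t ^ (m mod R)) else 0)" if "m < R * R" for m
      using a that by (simp only: CDA_relay_def index_mat(1) k_def c_def prod.case)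
    moreover have "(CDA_relay R \<theta> \<delta> \<sigma> t b *\<^sub>v s) $ a
        = (\<Sum>m<R * R. CDA_relay R \<theta> \<delta> \<sigma> t b $$ (a, m) * s $ m)"
      using a s by (simp add: CDA_relay_def scalar_prod_def atLeast0LessThan)
    ultimately show ?thesis by (simp cong: if_cong) (intro sum.cong, auto)
  qed
  \<comment> \<open>On the block, \<open>(k * R + i) mod R = i\<close> because \<open>i < R\<close>,
    so the exponent of \<open>t\<close> is the summation index.\<close>
  also have "\<dots> = (\<Sum>i<R. c * (\<sigma> ^^ b) (t ^ i) * s $ (k * R + i))"
    by (subst sum_block[OF k]) (intro sum.cong, auto)
  also have "\<dots> = col (M_CDA R \<theta> \<delta> \<sigma> t s) b $ a"
    using a assms(1) by (simp add: M_CDA_def k_def c_def sum_distrib_left mult_ac)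
  finally show "col (M_CDA R \<theta> \<delta> \<sigma> t s) b $ a = (CDA_relay R \<theta> \<delta> \<sigma> t b *\<^sub>v s) $ a" ..
qed

lemma CDA_relay_row_orthogonal:
  assumes "b < R"
  shows "diagonal_mat (CDA_relay R \<theta> \<delta> \<sigma> t b * mat_adjoint (CDA_relay R \<theta> \<delta> \<sigma> t b))"
  unfolding diagonal_mat_def
proof (intro allI impI)
  let ?A = "CDA_relay R \<theta> \<delta> \<sigma> t b"
  fix i j assume "i < dim_row (?A * mat_adjoint ?A)" "j < dim_col (?A * mat_adjoint ?A)" "i \<noteq> j"
  then have ij: "i < R" "j < R" "i \<noteq> j"
    by (simp_all add: CDA_relay_def mat_adjoint_def)
  then have "(i + R - b) mod R \<noteq> (j + R - b) mod R"
    using cyclic_shift_inj assms by blast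
  \<comment> \<open>No \<open>m\<close> has \<open>m div R\<close> equal to both residues, so in
    each summand one of the two factors is 0: the scalar product vanishes term by term, without
    cancellation.\<close>
  then show "(?A * mat_adjoint ?A) $$ (i, j) = 0"
    using ij
    by (auto simp: scalar_prod_def mat_adjoint_def mat_of_rows_def CDA_relay_def intro!: sum.neutral)
qed

theorem mainTheorem2:
  fixes R :: nat and F K :: "complex set" and t \<delta> :: complex
    and \<sigma> :: "complex \<Rightarrow> complex" and \<theta> :: real
  assumes "R \<ge> 1"
    and "subfield F complex_ring"
    and "K = generate_field complex_ring (insert t F)"
    and "cyclic_galois_extension R F K \<sigma>"
    and "\<delta> \<in> F - {0}"
    and "division_algebra (cyclic_algebra R K \<sigma> \<delta>)"
    and "\<theta> > 0"
  shows "CLRO_DSTC (R * R) R R (M_CDA R \<theta> \<delta> \<sigma> t)"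
  unfolding CLRO_DSTC_def is_relay_matrix_def
\<comment> \<open>No conjugated variable occurs in the design, so every column meets the first
  alternative of Condition 1.\<close>
proof (intro conjI ballI exI[of _ "CDA_relay R \<theta> \<delta> \<sigma> t"] allI impI)
  show "M_CDA R \<theta> \<delta> \<sigma> t s \<in> carrier_mat R R" for s
    by (simp add: M_CDA_def)
  show "CDA_relay R \<theta> \<delta> \<sigma> t j \<in> carrier_mat R (R * R)" for j
    by (simp add: CDA_relay_def)
qed (use col_M_CDA CDA_relay_row_orthogonal in auto)

end
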